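(* For all integers $n \geq 3$ and $k \geq 1$, the cycle $C_n$ on $n$ vertices satisfies \[\gamma_{all,k}^\infty(C_n) = \gamma_k(C_n) = \Big\lceil \frac{n}{2k+1}\Big\rceil.\]
   Context: Graphs are finite and simple; $d(u,v)$ denotes graph distance, and $N_k[x]=\{v: d(x,v)\le k\}$. A multiset $D$ of vertices of $G$ is a distance-$k$ dominating set if every vertex of $V(G)\setminus D$ is at distance at most $k$ from some element of $D$; $\gamma_k(G)$ is the minimum cardinality of such a multiset. Let $\mathbb{D}_{k,q}(G)$ be the set of distance-$k$ dominating multisets of cardinality $q$. For $D=\{v_1,\dots,v_q\}$ and $D'=\{u_1,\dots,u_q\}$ in $\mathbb{D}_{k,q}(G)$, $D$ transforms to $D'$ if (for some indexing) $u_i\in N_k[v_i]$ for all $i$. An eternal distance-$k$ dominating family is a subset $\mathcal{E}\subseteq\mathbb{D}_{k,q}(G)$ for some $q$ such that for every $D\in\mathcal{E}$ and every vertex $v$ there is $D'\in\mathcal{E}$ with $v\in D'$ and $D$ transforms to $D'$. The eternal distance-$k$ domination number $\gamma_{all,k}^\infty(G)$ is the minimum $q$ for which an eternal distance-$k$ dominating family of $G$ (consisting of multisets of size $q$) exists. (Informally: guards occupy a distance-$k$ dominating multiset; after each attack on a vertex, every guard moves distance at most $k$ so that the new positions form a distance-$k$ dominating multiset containing the attacked vertex.) *)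

theory Defs
  imports "Graph_Theory.Shortest_Path" "HOL-Library.Multiset"
begin

text \<open>
  Finite simple graphs are the symmetric loop-free digraphs without parallel arcs of the locale
  \<^locale>\<open>graph\<close>. In this locale \<open>\<mu> f u v\<close> is the infimum of the \<open>f\<close>-weights of the
  walks from \<open>u\<close> to \<open>v\<close>; with all weights equal to 1 it is the graph distance, which is
  infinite between different components.
\<close>

context graph
begin

definition graph_dist :: "'a \<Rightarrow> 'a \<Rightarrow> ereal" where
  "graph_dist u v = \<mu> (\<lambda>_. 1) u v"

definition closed_nbhd :: "nat \<Rightarrow> 'a \<Rightarrow> 'a set" where
  "closed_nbhd k x = {v \<in> verts G. graph_dist x v \<le> ereal (real k)}"

definition dominating_multiset :: "nat \<Rightarrow> 'a multiset \<Rightarrow> bool" where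
  "dominating_multiset k D \<longleftrightarrow>
     set_mset D \<subseteq> verts G \<and>
     (\<forall>v \<in> verts G - set_mset D. \<exists>x \<in> set_mset D. graph_dist v x \<le> ereal (real k))"

definition dominating_multisets :: "nat \<Rightarrow> nat \<Rightarrow> 'a multiset set" where
  "dominating_multisets k q = {D. dominating_multiset k D \<and> size D = q}"

definition domination_number :: "nat \<Rightarrow> nat" where
  "domination_number k = (LEAST q. dominating_multisets k q \<noteq> {})"

text \<open>
  \<^const>\<open>rel_mset\<close> asks for enumerations of the two multisets, as lists of equal length, whose
  entries are related position by position.
\<close>

definition transforms :: "nat \<Rightarrow> 'a multiset \<Rightarrow> 'a multiset \<Rightarrow> bool" where
  "transforms k D D' \<longleftrightarrow> rel_mset (\<lambda>v u. u \<in> closed_nbhd k v) D D'"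

text \<open>
  A family has to be nonempty: the empty family satisfies the closure condition vacuously,
  for every \<open>q\<close>.
\<close>

definition eternal_dominating_family :: "nat \<Rightarrow> nat \<Rightarrow> 'a multiset set \<Rightarrow> bool" where
  "eternal_dominating_family k q E \<longleftrightarrow>
     E \<noteq> {} \<and> E \<subseteq> dominating_multisets k q \<and>
     (\<forall>D \<in> E. \<forall>v \<in> verts G. \<exists>D' \<in> E. v \<in># D' \<and> transforms k D D')"

definition eternal_domination_number :: "nat \<Rightarrow> nat" where
  "eternal_domination_number k = (LEAST q. \<exists>E. eternal_dominating_family k q E)"

text \<open>Both minima range over nonempty sets, as the multiset of all vertices shows.\<close>

lemma graph_dist_self_le:
  assumes "v \<in> verts G"
  shows "graph_dist v v \<le> ereal (real k)"
proof -
  have "awalk v [] v"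
    using assms by (simp add: awalk_Nil_iff)
  then have "graph_dist v v \<le> ereal (awalk_cost (\<lambda>_. 1) [])"
    unfolding graph_dist_def by (rule min_cost_le_walk_cost)
  also have "\<dots> \<le> ereal (real k)"
    by simp
  finally show ?thesis .
qed

lemma eternal_dominating_family_verts:
  "eternal_dominating_family k (card (verts G)) {mset_set (verts G)}"
proof -
  have dom: "mset_set (verts G) \<in> dominating_multisets k (card (verts G))"
    by (simp add: dominating_multisets_def dominating_multiset_def)
  have "transforms k (mset_set (verts G)) (mset_set (verts G))"
    unfolding transforms_def
    by (rule multiset.rel_refl_strong) (simp add: closed_nbhd_def graph_dist_self_le)
  with dom show ?thesis
    by (simp add: eternal_dominating_family_def)
qed

lemma dominating_multisets_nonempty: "\<exists>q. dominating_multisets k q \<noteq> {}"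
  using eternal_dominating_family_verts[of k]
  by (auto simp: eternal_dominating_family_def)

end

definition cycle_graph :: "nat \<Rightarrow> (nat, nat \<times> nat) pre_digraph" where
  "cycle_graph n =
     \<lparr> verts = {..<n},
       arcs = {(i, j). i < n \<and> j < n \<and> (j = (i + 1) mod n \<or> i = (j + 1) mod n)},
       tail = fst, head = snd \<rparr>"

text \<open>
  For \<open>n < 3\<close> the formula does not give a cycle, and for \<open>n = 1\<close> it even gives a loop.
\<close>

lemma graph_cycle_graph:
  assumes "n \<ge> 3"
  shows "graph (cycle_graph n)"
proof
  have "arcs (cycle_graph n) \<subseteq> {..<n} \<times> {..<n}"
    by (auto simp: cycle_graph_def)
  then show "finite (arcs (cycle_graph n))"
    by (rule finite_subset) simp
  show "tail (cycle_graph n) e \<noteq> head (cycle_graph n) e" if "e \<in> arcs (cycle_graph n)" for e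
    using that assms by (auto simp: cycle_graph_def mod_if split: if_splits)
qed (auto simp: cycle_graph_def arc_to_ends_def symmetric_def arcs_ends_def sym_def)

end

theory Submission
  imports Defs
begin

text \<open>
  Place \<open>q = \<lceil>n / (2k+1)\<rceil>\<close> guards at \<open>r, r + (2k+1), \<dots>, r + (q-1)(2k+1)\<close> modulo \<open>n\<close>. Every
  vertex differs from one of these positions by some \<open>d\<close> with \<open>|d| \<le> k\<close>, so an attack is answered by
  rotating the whole configuration by \<open>d\<close>: the configurations for all \<open>r\<close> form an eternal
  dominating family. Conversely a guard dominates at most \<open>2k+1\<close> vertices, so \<open>q\<close> guards are needed
  already for domination.
\<close>

section \<open>Distance bounds as bounds on walk length\<close>

lemma (in graph) graph_dist_le_iff:
  "graph_dist u v \<le> ereal (real k) \<longleftrightarrow> (\<exists>p. awalk u p v \<and> length p \<le> k)"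
proof
  assume "graph_dist u v \<le> ereal (real k)"
  also have "ereal (real k) < ereal (real k + 1)"
    by simp
  finally have "(INF p\<in>{p. awalk u p v}. ereal (awalk_cost (\<lambda>_. 1) p)) < ereal (real k + 1)"
    by (simp add: graph_dist_def \<mu>_def)
  then show "\<exists>p. awalk u p v \<and> length p \<le> k"
    by (auto simp: INF_less_iff awalk_cost_def sum_list_triv)
next
  assume "\<exists>p. awalk u p v \<and> length p \<le> k"
  then obtain p where p: "awalk u p v" "length p \<le> k"
    by blast
  have "graph_dist u v \<le> ereal (awalk_cost (\<lambda>_. 1) p)"
    unfolding graph_dist_def using p(1) by (rule min_cost_le_walk_cost)
  also have "\<dots> \<le> ereal (real k)"
    using p(2) by (simp add: awalk_cost_def sum_list_triv)
  finally show "graph_dist u v \<le> ereal (real k)" .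
qed

section \<open>Vertices of the cycle as residues of integers\<close>

locale cycle =
  fixes n :: nat
  assumes n_ge_3: "n \<ge> 3"

sublocale cycle \<subseteq> graph "cycle_graph n"
  by (rule graph_cycle_graph[OF n_ge_3])

context cycle
begin

text \<open>Integer arguments give both directions around the cycle a uniform form, free of
  truncated subtraction.\<close>

definition residue :: "int \<Rightarrow> nat" where
  "residue x = nat (x mod int n)"

lemma residue_less: "residue x < n"
  using n_ge_3 by (simp add: residue_def nat_less_iff)

lemma residue_of_nat: "v < n \<Longrightarrow> residue (int v) = v"
  by (simp add: residue_def)

lemma int_residue: "int (residue x) = x mod int n"
  using n_ge_3 by (simp add: residue_def)

lemma residue_eq_iff: "residue x = residue y \<longleftrightarrow> x mod int n = y mod int n"
  by (metis int_residue residue_def)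

lemma residue_add_residue: "residue (int (residue x) + d) = residue (x + d)"
  by (simp add: residue_eq_iff int_residue mod_simps)

lemma verts_cycle: "verts (cycle_graph n) = {..<n}"
  by (simp add: cycle_graph_def)

lemma arc_cycle_iff:
  "e \<in> arcs (cycle_graph n) \<longleftrightarrow>
     fst e < n \<and> snd e < n \<and>
     (snd e = residue (int (fst e) + 1) \<or> fst e = residue (int (snd e) + 1))"
proof -
  have "residue (int i + 1) = (i + 1) mod n" for i
    by (metis nat_int of_nat_1 of_nat_add residue_def zmod_int)
  then show ?thesis
    by (auto simp: cycle_graph_def)
qed

lemma tail_head_cycle: "tail (cycle_graph n) = fst" "head (cycle_graph n) = snd"
  by (simp_all add: cycle_graph_def)

section \<open>Walks and displacements\<close>

text \<open>Each arc contributes \<open>1\<close> or \<open>-1\<close>, and \<open>d\<close> is the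
  signed sum; it need not be the shortest displacement.\<close>

lemma awalk_displacement:
  "awalk u p v \<Longrightarrow> \<exists>d. \<bar>d\<bar> \<le> int (length p) \<and> v = residue (int u + d)"
proof (induction p arbitrary: u)
  case Nil
  then show ?case
    by (intro exI[of _ 0]) (auto simp: awalk_Nil_iff verts_cycle residue_of_nat)
next
  case (Cons e p)
  then have e: "e \<in> arcs (cycle_graph n)" "fst e = u" and w: "awalk (snd e) p v"
    by (auto simp: awalk_Cons_iff tail_head_cycle)
  obtain d where d: "\<bar>d\<bar> \<le> int (length p)" "v = residue (int (snd e) + d)"
    using Cons.IH[OF w] by blast
  from e consider "snd e = residue (int u + 1)" | "u = residue (int (snd e) + 1)" "snd e < n"
    by (auto simp: arc_cycle_iff)
  then show ?case
  proof cases
    case 1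
    then have "v = residue (int u + (1 + d))"
      by (simp add: d(2) residue_add_residue add.assoc)
    then show ?thesis
      using d(1) by (intro exI[of _ "1 + d"]) auto
  next
    case 2
    then have "v = residue (int u + (d - 1))"
      by (simp add: d(2) residue_add_residue)
    then show ?thesis
      using d(1) by (intro exI[of _ "d - 1"]) auto
  qed
qed

text \<open>Walks may repeat vertices, so wrapping around the cycle, even several times, needs no
  separate case.\<close>

lemma awalk_forward: "\<exists>p. awalk (residue x) p (residue (x + int d)) \<and> length p = d"
proof (induction d arbitrary: x)
  case 0
  show ?case
    by (auto simp: awalk_Nil_iff verts_cycle residue_less)
next
  case (Suc d)
  obtain p where "awalk (residue (x + 1)) p (residue (x + 1 + int d))" "length p = d"
    using Suc by blast
  then have "awalk (residue x) ((residue x, residue (x + 1)) # p) (residue (x + int (Suc d)))"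
    by (simp add: awalk_Cons_iff arc_cycle_iff tail_head_cycle residue_less residue_add_residue
        add.assoc)
  then show ?case
    using \<open>length p = d\<close> by (metis length_Cons)
qed

lemma awalk_backward: "\<exists>p. awalk (residue x) p (residue (x - int d)) \<and> length p = d"
proof (induction d arbitrary: x)
  case 0
  show ?case
    by (auto simp: awalk_Nil_iff verts_cycle residue_less)
next
  case (Suc d)
  obtain p where "awalk (residue (x - 1)) p (residue (x - 1 - int d))" "length p = d"
    using Suc by blast
  moreover have "x - 1 - int d = x - int (Suc d)"
    by simp
  \<comment> \<open>\<open>diff_add_cancel\<close> exhibits the new arc as the reverse of a forward
    step, the second disjunct of \<open>arc_cycle_iff\<close>.\<close>
  ultimately have "awalk (residue x) ((residue x, residue (x - 1)) # p) (residue (x - int (Suc d)))"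
    by (simp only: awalk_Cons_iff arc_cycle_iff tail_head_cycle residue_less residue_add_residue
        fst_conv snd_conv diff_add_cancel simp_thms)
  then show ?case
    using \<open>length p = d\<close> by (metis length_Cons)
qed

lemma graph_dist_residue_le:
  assumes "\<bar>d\<bar> \<le> int k"
  shows "graph_dist (residue x) (residue (x + d)) \<le> ereal (real k)"
proof -
  have "\<exists>p. awalk (residue x) p (residue (x + d)) \<and> length p = nat \<bar>d\<bar>"
    using awalk_forward[of x "nat d"] awalk_backward[of x "nat (- d)"] by (cases "d \<ge> 0") simp_all
  moreover have "nat \<bar>d\<bar> \<le> k"
    using assms by simp
  ultimately show ?thesis
    unfolding graph_dist_le_iff by metis
qed

lemma graph_dist_le_displacement:
  assumes "graph_dist u v \<le> ereal (real k)"
  obtains d where "\<bar>d\<bar> \<le> int k" "v = residue (int u + d)"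
  using assms awalk_displacement unfolding graph_dist_le_iff by (meson of_nat_le_iff order_trans)

section \<open>Lower bound by counting\<close>

lemma dominating_multiset_card:
  assumes "dominating_multiset k D"
  shows "n \<le> size D * (2 * k + 1)"
proof -
  \<comment> \<open>\<open>?N x\<close> contains everything a guard at \<open>x\<close> dominates.
    On a short cycle different \<open>d\<close> may give the same vertex, so its cardinality is only
    bounded above.\<close>
  let ?N = "\<lambda>x. (\<lambda>d. residue (int x - d)) ` {- int k..int k}"
  have "{..<n} \<subseteq> (\<Union>x\<in>set_mset D. ?N x)"
  proof
    fix v assume v: "v \<in> {..<n}"
    \<comment> \<open>An occupied vertex is its own witness, at distance 0.\<close>
    obtain x where x: "x \<in># D" "graph_dist v x \<le> ereal (real k)"
      using assms v graph_dist_self_le[of v k] unfolding dominating_multiset_def verts_cycle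
      by blast
    from x(2) obtain d where "\<bar>d\<bar> \<le> int k" "x = residue (int v + d)"
      by (rule graph_dist_le_displacement)
    moreover from this have "v = residue (int x - d)"
      using residue_add_residue[of "int v + d" "- d"] v by (simp add: residue_of_nat)
    ultimately show "v \<in> (\<Union>x\<in>set_mset D. ?N x)"
      using x(1) by (intro UN_I[of x] image_eqI[of _ _ d]) auto
  qed
  then have "card {..<n} \<le> card (\<Union>x\<in>set_mset D. ?N x)"
    by (intro card_mono) auto
  also have "\<dots> \<le> (\<Sum>x\<in>set_mset D. card (?N x))"
    by (intro card_UN_le) auto
  also have "\<dots> \<le> (\<Sum>x\<in>set_mset D. 2 * k + 1)"
  proof (intro sum_mono)
    fix x
    show "card (?N x) \<le> 2 * k + 1"
      using card_image_le[of "{- int k..int k}" "\<lambda>d. residue (int x - d)"] by simp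
  qed
  also have "\<dots> = card (set_mset D) * (2 * k + 1)"
    by simp
  also have "\<dots> \<le> size D * (2 * k + 1)"
    using size_mset_mono[OF mset_set_set_mset_msubset[of D]] by (intro mult_le_mono1) simp
  finally show ?thesis
    by simp
qed

section \<open>Equally spaced guards and their rotations\<close>

text \<open>For large \<open>q\<close> positions may coincide modulo \<open>n\<close>; the multiset
  image still has size \<open>q\<close>.\<close>

definition spaced_guards :: "nat \<Rightarrow> nat \<Rightarrow> int \<Rightarrow> nat multiset" where
  "spaced_guards k q r = image_mset (\<lambda>i. residue (r + int i * (2 * int k + 1))) (mset_set {..<q})"

text \<open>Round the offset \<open>t\<close> of \<open>v\<close> from \<open>r\<close> to the
  nearest multiple of \<open>2 * k + 1\<close>. If this overshoots the last guard, \<open>v\<close>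
  lies just before \<open>r + n\<close>, which is guard \<open>0\<close> again.\<close>

lemma spaced_guards_near:
  assumes "n \<le> q * (2 * k + 1)" "v < n"
  obtains i d where "i < q" "\<bar>d\<bar> \<le> int k" "v = residue (r + int i * (2 * int k + 1) + d)"
proof -
  define t where "t = (int v - r) mod int n"
  define m where "m = 2 * int k + 1"
  have t: "0 \<le> t" "t < int n"
    using n_ge_3 by (auto simp: t_def)
  have v: "v = residue (r + t)"
  proof -
    have "residue (r + t) = residue (int v)"
      by (simp add: residue_eq_iff t_def mod_simps)
    then show ?thesis
      using assms(2) by (simp add: residue_of_nat)
  qed
  have nm: "int n \<le> int q * m"
  proof -
    have "int n \<le> int (q * (2 * k + 1))"
      using assms(1) by (simp only: of_nat_le_iff)
    also have "\<dots> = int q * m"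
      by (simp add: m_def algebra_simps)
    finally show ?thesis .
  qed
  have "q > 0"
    using assms n_ge_3 by (cases q) auto
  \<comment> \<open>Adding \<open>k\<close> before dividing by \<open>m = 2 * k + 1\<close> turns
    rounding down into rounding to the nearest multiple.\<close>
  define j where "j = (t + int k) div m"
  have m: "m > 0" by (simp add: m_def)
  have j: "j * m \<le> t + int k" "t + int k < j * m + m"
    using m div_mult_mod_eq[of "t + int k" m] pos_mod_bound[of m "t + int k"]
      pos_mod_sign[of m "t + int k"] unfolding j_def by linarith+
  have j0: "j \<ge> 0"
    using t m by (simp add: j_def pos_imp_zdiv_nonneg_iff)
  show thesis
  proof (cases "j < int q")
    case True
    show thesis
    proof (rule that[of "nat j" "t - j * m"])
      show "nat j < q" using True j0 by linarith
      show "\<bar>t - j * m\<bar> \<le> int k" using j m_def by linarith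
      show "v = residue (r + int (nat j) * (2 * int k + 1) + (t - j * m))"
        unfolding m_def[symmetric] using j0 v by simp
    qed
  next
    \<comment> \<open>Here \<open>n \<le> q * m \<le> j * m \<le> t + k\<close>, so guard
      \<open>0\<close> is reached across the wrap-around with displacement
      \<open>t - n\<close>.\<close>
    case False
    then have "int q * m \<le> j * m"
      using m by (intro mult_right_mono) auto
    then have "int n \<le> t + int k"
      using nm j by linarith
    show thesis
    proof (rule that[of 0 "t - int n"])
      show "0 < q" by fact
      show "\<bar>t - int n\<bar> \<le> int k" using \<open>int n \<le> t + int k\<close> t by linarith
      have "residue (r + t) = residue (r + t - int n)"
        by (simp add: residue_eq_iff)
      then show "v = residue (r + int 0 * (2 * int k + 1) + (t - int n))"
        using v by (simp add: algebra_simps)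
    qed
  qed
qed

lemma spaced_guards_dominating:
  assumes "n \<le> q * (2 * k + 1)"
  shows "spaced_guards k q r \<in> dominating_multisets k q"
proof -
  have "\<exists>x\<in>#spaced_guards k q r. graph_dist v x \<le> ereal (real k)" if v: "v < n" for v
  proof -
    obtain i d where id: "i < q" "\<bar>d\<bar> \<le> int k" "v = residue (r + int i * (2 * int k + 1) + d)"
      using spaced_guards_near[OF assms v] by blast
    have "graph_dist v (residue (r + int i * (2 * int k + 1))) \<le> ereal (real k)"
      using graph_dist_residue_le[of "- d" k "r + int i * (2 * int k + 1) + d"] id by simp
    then show ?thesis
      using id(1) by (auto simp: spaced_guards_def)
  qed
  then show ?thesis
    by (auto simp: dominating_multisets_def dominating_multiset_def verts_cycle spaced_guards_def
        residue_less)
qed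

lemma spaced_guards_transforms:
  assumes "\<bar>d\<bar> \<le> int k"
  shows "transforms k (spaced_guards k q r) (spaced_guards k q (r + d))"
proof -
  have "residue (r + d + y) \<in> closed_nbhd k (residue (r + y))" for y
    using graph_dist_residue_le[OF assms, of "r + y"]
    by (simp add: closed_nbhd_def verts_cycle residue_less algebra_simps)
  \<comment> \<open>Both configurations are images of the same index multiset, so
    \<open>multiset.rel_map\<close> reduces the pairing to guard \<open>i\<close> with its own
    rotated copy.\<close>
  then show ?thesis
    unfolding transforms_def spaced_guards_def multiset.rel_map by (intro multiset.rel_refl)
qed

lemma eternal_dominating_family_spaced_guards:
  assumes "n \<le> q * (2 * k + 1)"
  shows "eternal_dominating_family k q (range (spaced_guards k q))"
proof -
  have "\<exists>s. v \<in># spaced_guards k q s \<and> transforms k (spaced_guards k q r) (spaced_guards k q s)"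
    if v: "v < n" for r v
  proof -
    obtain i d where id: "i < q" "\<bar>d\<bar> \<le> int k" "v = residue (r + int i * (2 * int k + 1) + d)"
      using spaced_guards_near[OF assms v] by blast
    then have "v = residue (r + d + int i * (2 * int k + 1))"
      by (simp add: algebra_simps)
    then have "v \<in># spaced_guards k q (r + d)"
      using id(1) by (auto simp: spaced_guards_def)
    then show ?thesis
      using spaced_guards_transforms[OF id(2)] by blast
  qed
  then show ?thesis
    using spaced_guards_dominating[OF assms]
    by (auto simp: eternal_dominating_family_def verts_cycle)
qed

section \<open>The two minima\<close>

lemma dominating_multisets_nonempty_iff:
  "dominating_multisets k q \<noteq> {} \<longleftrightarrow> n \<le> q * (2 * k + 1)"
  using dominating_multiset_card spaced_guards_dominating
  by (force simp: dominating_multisets_def)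

text \<open>The criterion agrees with the one for plain domination, so both numbers are the least
  element of the same set of \<open>q\<close>.\<close>

lemma eternal_dominating_family_exists_iff:
  "(\<exists>E. eternal_dominating_family k q E) \<longleftrightarrow> n \<le> q * (2 * k + 1)"
proof
  assume "\<exists>E. eternal_dominating_family k q E"
  then have "dominating_multisets k q \<noteq> {}"
    by (auto simp: eternal_dominating_family_def)
  then show "n \<le> q * (2 * k + 1)"
    by (simp add: dominating_multisets_nonempty_iff)
qed (blast intro: eternal_dominating_family_spaced_guards)

end

lemma Least_mult_ge_eq_ceiling:
  fixes n m :: nat
  assumes "m > 0"
  shows "int (LEAST q. n \<le> q * m) = \<lceil>real n / real m\<rceil>"
proof -
  have iff: "n \<le> q * m \<longleftrightarrow> nat \<lceil>real n / real m\<rceil> \<le> q" for q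
  proof -
    have "n \<le> q * m \<longleftrightarrow> real n \<le> real q * real m"
      by (metis of_nat_le_iff of_nat_mult)
    also have "\<dots> \<longleftrightarrow> real n / real m \<le> real q"
      using assms by (simp add: divide_le_eq)
    finally show ?thesis
      by (simp add: nat_le_iff ceiling_le_iff)
  qed
  have "(LEAST q. n \<le> q * m) = nat \<lceil>real n / real m\<rceil>"
    unfolding iff by (rule Least_equality) auto
  moreover have "\<lceil>real n / real m\<rceil> \<ge> 0"
    by (smt (verit) divide_nonneg_nonneg of_nat_0_le_iff zero_le_ceiling)
  ultimately show ?thesis
    by simp
qed

theorem theorem1:
  fixes n k :: nat
  assumes "n \<ge> 3" and "k \<ge> 1"
  shows "graph.eternal_domination_number (cycle_graph n) k
           = graph.domination_number (cycle_graph n) k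
       \<and> int (graph.domination_number (cycle_graph n) k)
           = \<lceil>real n / real (2 * k + 1)\<rceil>"
proof -
  interpret cycle n
    by unfold_locales (rule assms(1))
  show ?thesis
    unfolding eternal_domination_number_def domination_number_def
      eternal_dominating_family_exists_iff dominating_multisets_nonempty_iff
    by (simp only: Least_mult_ge_eq_ceiling)
qed

end
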